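(* Let $p,q$ be coprime integers with $0<p<q$, let $L_{(p,q)}=\mathbf{R}_{\ge 0}\cdot(p,q)$, and write $\mathrm{SC}(q/p)=[[d_1,\dots,d_p]]$. The walk in the plane which starts at $(1,1)$ and at each step moves towards the half-line $L_{(p,q)}$ until reaching it is the following: (i) the walker starts at $(1,1)$; (ii) for $i=1,\dots,p-1$ successively, the walker moves $d_i$ unit steps vertically (each step $(0,1)$), followed by one unit step horizontally (step $(1,0)$); (iii) finally, the walker makes $d_p-1$ unit steps vertically, and the walk ends (at $(p,q)$).
   Context: The walk: steps are the unit vectors $(1,0)$ (horizontal) and $(0,1)$ (vertical). Moving towards $L_{(p,q)}$ means: if the current point is strictly below $L_{(p,q)}$ (in the relative interior of the cone generated by $(1,0)$ and $(p,q)$, or on the positive $x$-axis) the next step is $(0,1)$; if it is strictly above $L_{(p,q)}$ the next step is $(1,0)$; the walk stops the first time the current point lies on $L_{(p,q)}$. The staircase continued fraction $\mathrm{SC}(q/p)$: define $d_1,r_1$ as quotient and remainder of the Euclidean division of $q$ by $p$, so $q=d_1p+r_1$, and recursively for $k\ge 2$ let $d_k,r_k$ be quotient and remainder of the division of $q+r_{k-1}$ by $p$, so $q+r_{k-1}=d_kp+r_k$ with $0\le r_k<p$. Stop at the first index $i\ge1$ with $r_i=0$ and set $\mathrm{SC}(q/p)=[[d_1,\dots,d_i]]$. For $p,q$ coprime this first index is $i=p$. *)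

theory Defs
  imports "HOL-Analysis.Analysis"
begin

text \<open>
  Remainders and quotients of the staircase continued fraction of \<open>q/p\<close>. The convention
  \<open>r\<^sub>0 = 0\<close> makes the first division \<open>q = d\<^sub>1 p + r\<^sub>1\<close> an instance of
  \<open>q + r\<^sub>k\<^sub>-\<^sub>1 = d\<^sub>k p + r\<^sub>k\<close>; only indices \<open>k \<ge> 1\<close> are meaningful for the quotients.
\<close>

primrec sc_rem :: "nat \<Rightarrow> nat \<Rightarrow> nat \<Rightarrow> nat" where
  "sc_rem q p 0 = 0"
| "sc_rem q p (Suc k) = (q + sc_rem q p k) mod p"

definition sc_quot :: "nat \<Rightarrow> nat \<Rightarrow> nat \<Rightarrow> nat" where
  "sc_quot q p k = (q + sc_rem q p (k - 1)) div p"

definition sc_length :: "nat \<Rightarrow> nat \<Rightarrow> nat" where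
  "sc_length q p = (LEAST i. 1 \<le> i \<and> sc_rem q p i = 0)"

definition SC :: "nat \<Rightarrow> nat \<Rightarrow> nat list" where
  "SC q p = map (sc_quot q p) [1..<Suc (sc_length q p)]"

type_synonym point = "real \<times> real"

definition half_line :: "point \<Rightarrow> point set" where
  "half_line v = {t *\<^sub>R v | t. 0 \<le> t}"

text \<open>
  For \<open>v\<close> in the open first quadrant, these two regions and the half-line through \<open>v\<close>
  partition the closed first quadrant.
\<close>

definition strictly_below :: "point \<Rightarrow> point \<Rightarrow> bool" where
  "strictly_below v x \<longleftrightarrow>
     x \<in> rel_interior (convex_cone hull {(1, 0), v}) \<or> (\<exists>a>0. x = (a, 0))"

definition strictly_above :: "point \<Rightarrow> point \<Rightarrow> bool" where
  "strictly_above v x \<longleftrightarrow>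
     x \<in> rel_interior (convex_cone hull {(0, 1), v}) \<or> (\<exists>b>0. x = (0, b))"

inductive step_towards :: "point \<Rightarrow> point \<Rightarrow> point \<Rightarrow> bool" for v where
  vertical: "strictly_below v x \<Longrightarrow> step_towards v x (x + (0, 1))"
| horizontal: "strictly_above v x \<Longrightarrow> step_towards v x (x + (1, 0))"

text \<open>
  A walk is the list of all points visited, including the starting point and the end point. It
  must end on the half-line, and no earlier point may lie on it.
\<close>

definition walk_towards :: "point \<Rightarrow> point \<Rightarrow> point list \<Rightarrow> bool" where
  "walk_towards v x0 xs \<longleftrightarrow>
     xs \<noteq> [] \<and> hd xs = x0 \<and>
     (\<forall>i. Suc i < length xs \<longrightarrow> xs ! i \<notin> half_line v \<and> step_towards v (xs ! i) (xs ! Suc i)) \<and>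
     last xs \<in> half_line v"

text \<open>The points visited when starting at a point and making the given steps in order.\<close>

primrec trajectory :: "point \<Rightarrow> point list \<Rightarrow> point list" where
  "trajectory x [] = [x]"
| "trajectory x (s # ss) = x # trajectory (x + s) ss"

end

theory Submission imports Defs begin

text \<open>
  In the open first quadrant a point \<open>(x, y)\<close> lies below, on or above the half-line according to the
  sign of \<open>p y - q x\<close>. Since \<open>r\<^sub>k = k q mod p\<close>, coprimality makes \<open>r\<^sub>k\<close> vanish first at \<open>k = p\<close>,
  and the quotients satisfy \<open>d\<^sub>1 + \<dots> + d\<^sub>k = \<lfloor>k q / p\<rfloor>\<close>. The walk enters column \<open>k\<close> at
  height \<open>1 + \<lfloor>(k - 1) q / p\<rfloor>\<close> and, as \<open>k q / p\<close> is not an integer for \<open>k < p\<close>, is first above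
  the half-line at height \<open>1 + \<lfloor>k q / p\<rfloor>\<close>, that is, after \<open>d\<^sub>k\<close> vertical steps.
\<close>

section \<open>The two regions as open sectors\<close>

text \<open>The determinant with columns \<open>u\<close> and \<open>v\<close>; it is positive
  exactly when \<open>v\<close> is reached from \<open>u\<close> by a counterclockwise turn of less
  than a half turn.\<close>

definition cross :: "point \<Rightarrow> point \<Rightarrow> real" where
  "cross u v = fst u * snd v - snd u * fst v"

text \<open>By Cramer's rule the coordinates of \<open>x\<close> in the basis \<open>u\<close>,
  \<open>v\<close> are \<open>cross x v / cross u v\<close> and
  \<open>cross u x / cross u v\<close>.\<close>

lemma convex_cone_hull_pair_cross:
  assumes "cross u v > 0"
  shows "convex_cone hull {u, v} = {x. 0 \<le> cross u x \<and> 0 \<le> cross x v}"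
proof
  have "convex_cone {x. 0 \<le> cross u x \<and> 0 \<le> cross x v}"
    unfolding convex_cone_iff
  proof (intro conjI ballI allI impI)
    show "0 \<in> {x. 0 \<le> cross u x \<and> 0 \<le> cross x v}"
      by (simp add: cross_def)
  next
    fix x y assume "x \<in> {x. 0 \<le> cross u x \<and> 0 \<le> cross x v}" "y \<in> {x. 0 \<le> cross u x \<and> 0 \<le> cross x v}"
    then show "x + y \<in> {x. 0 \<le> cross u x \<and> 0 \<le> cross x v}"
      by (simp add: cross_def algebra_simps)
  next
    fix x and c :: real assume "x \<in> {x. 0 \<le> cross u x \<and> 0 \<le> cross x v}" "0 \<le> c"
    then have "0 \<le> c * cross u x" "0 \<le> c * cross x v"
      by simp_all
    then show "c *\<^sub>R x \<in> {x. 0 \<le> cross u x \<and> 0 \<le> cross x v}"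
      by (simp add: cross_def algebra_simps)
  qed
  then show "convex_cone hull {u, v} \<subseteq> {x. 0 \<le> cross u x \<and> 0 \<le> cross x v}"
    using assms by (intro hull_minimal) (auto simp: cross_def algebra_simps)
next
  let ?K = "convex_cone hull {u, v}"
  have K: "convex_cone ?K" and uv: "u \<in> ?K" "v \<in> ?K"
    by (auto intro: convex_cone_convex_cone_hull hull_inc)
  show "{x. 0 \<le> cross u x \<and> 0 \<le> cross x v} \<subseteq> ?K"
  proof clarify
    fix x assume "0 \<le> cross u x" "0 \<le> cross x v"
    then have "(cross x v / cross u v) *\<^sub>R u + (cross u x / cross u v) *\<^sub>R v \<in> ?K"
      using K uv assms by (intro convex_cone_add convex_cone_scaleR) auto
    also have "(cross x v / cross u v) *\<^sub>R u + (cross u x / cross u v) *\<^sub>R v = x"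
      using assms by (simp add: prod_eq_iff field_simps) (simp add: cross_def algebra_simps)
    finally show "x \<in> ?K" .
  qed
qed

lemma rel_interior_convex_cone_hull_pair:
  assumes "cross u v > 0"
  shows "rel_interior (convex_cone hull {u, v}) = {x. 0 < cross u x \<and> 0 < cross x v}"
proof -
  \<comment> \<open>Normals of the two half-planes that cut out the cone: \<open>u\<close> and
    \<open>v\<close> turned by a right angle towards its inside.\<close>
  have nz: "(- snd u, fst u) \<noteq> 0" "(snd v, - fst v) \<noteq> 0"
    using assms by (auto simp: cross_def zero_prod_def)
  have "convex_cone hull {u, v} = {x. (- snd u, fst u) \<bullet> x \<ge> 0} \<inter> {x. (snd v, - fst v) \<bullet> x \<ge> 0}"
    unfolding convex_cone_hull_pair_cross[OF assms]
    by (auto simp: cross_def inner_prod_def algebra_simps)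
  then have "interior (convex_cone hull {u, v}) = {x. 0 < cross u x \<and> 0 < cross x v}"
    unfolding \<open>convex_cone hull {u, v} = _\<close> interior_Int
      interior_halfspace_ge[OF nz(1)] interior_halfspace_ge[OF nz(2)]
    by (auto simp: cross_def inner_prod_def algebra_simps)
  \<comment> \<open>A witness that the interior is nonempty, so that it coincides with the relative
    interior.\<close>
  moreover have "u + v \<in> {x. 0 < cross u x \<and> 0 < cross x v}"
    using assms by (simp add: cross_def algebra_simps)
  ultimately show ?thesis
    by (metis empty_iff rel_interior_nonempty_interior)
qed

lemma strictly_below_iff:
  assumes "a > 0" "b > 0" "x > 0" "y > 0"
  shows "strictly_below (a, b) (x, y) \<longleftrightarrow> a * y < b * x"
  using assms rel_interior_convex_cone_hull_pair[of "(1, 0)" "(a, b)"]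
  by (auto simp: strictly_below_def cross_def algebra_simps)

text \<open>The generators are taken in the order \<open>(a, b)\<close>, \<open>(0, 1)\<close>,
  which makes their determinant \<open>a\<close> positive. Since \<open>x > 0\<close>, the
  alternative of lying on the vertical axis cannot occur.\<close>

lemma strictly_above_iff:
  assumes "a > 0" "b > 0" "x > 0" "y > 0"
  shows "strictly_above (a, b) (x, y) \<longleftrightarrow> b * x < a * y"
  using assms rel_interior_convex_cone_hull_pair[of "(a, b)" "(0, 1)"]
  by (auto simp: strictly_above_def cross_def algebra_simps insert_commute)

lemma half_line_iff:
  assumes "a > 0" "b > 0" "x > 0" "y > 0"
  shows "(x, y) \<in> half_line (a, b) \<longleftrightarrow> a * y = b * x"
proof
  assume "a * y = b * x"
  then have "(x, y) = (x / a) *\<^sub>R (a, b)"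
    using assms by (simp add: field_simps)
  then show "(x, y) \<in> half_line (a, b)"
    using assms unfolding half_line_def by (intro CollectI exI[of _ "x / a"]) simp
qed (auto simp: half_line_def)


section \<open>Forced walks\<close>

text \<open>Existence, uniqueness and endpoint in one predicate, so that the walk can be built
  backwards from its end by prepending steps.\<close>

definition forced_walk :: "point \<Rightarrow> point \<Rightarrow> point list \<Rightarrow> point \<Rightarrow> bool" where
  "forced_walk v x ss z \<longleftrightarrow>
     (\<forall>xs. walk_towards v x xs \<longleftrightarrow> xs = trajectory x ss) \<and> last (trajectory x ss) = z"

lemma trajectory_neq_Nil [simp]: "trajectory x ss \<noteq> []" "[] \<noteq> trajectory x ss"
  by (cases ss; simp)+

lemma hd_trajectory [simp]: "hd (trajectory x ss) = x"
  by (cases ss) auto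

lemma walk_towards_Cons:
  assumes "ys \<noteq> []"
  shows "walk_towards v x (y # ys) \<longleftrightarrow>
    y = x \<and> x \<notin> half_line v \<and> step_towards v x (hd ys) \<and> walk_towards v (hd ys) ys"
proof -
  \<comment> \<open>Splitting off index 0 turns the remaining conditions into those for the
    tail.\<close>
  have all_nat: "(\<forall>i. P i) \<longleftrightarrow> P 0 \<and> (\<forall>i. P (Suc i))" for P :: "nat \<Rightarrow> bool"
    by (metis not0_implies_Suc)
  show ?thesis
    using assms unfolding walk_towards_def by (subst all_nat) (auto simp: hd_conv_nth)
qed

lemma walk_towards_singleton: "walk_towards v x [y] \<longleftrightarrow> y = x \<and> x \<in> half_line v"
  by (auto simp: walk_towards_def)

lemma forced_walk_end:
  assumes "x \<in> half_line v"
  shows "forced_walk v x [] x"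
proof -
  have "walk_towards v x xs \<longleftrightarrow> xs = [x]" for xs
  proof (cases xs)
    case (Cons y ys)
    then show ?thesis
      using assms by (cases "ys = []") (auto simp: walk_towards_singleton walk_towards_Cons)
  qed (simp add: walk_towards_def)
  then show ?thesis
    by (simp add: forced_walk_def)
qed

lemma forced_walk_step:
  assumes "x \<notin> half_line v" and "\<And>y. step_towards v x y \<longleftrightarrow> y = x + s"
    and "forced_walk v (x + s) ss z"
  shows "forced_walk v x (s # ss) z"
proof -
  have "walk_towards v x xs \<longleftrightarrow> xs = x # trajectory (x + s) ss" for xs
  proof (cases xs)
    case (Cons y ys)
    then show ?thesis
      using assms
      by (cases "ys = []") (auto simp: walk_towards_singleton walk_towards_Cons forced_walk_def)
  qed (simp add: walk_towards_def)
  then show ?thesis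
    using assms(3) by (simp add: forced_walk_def)
qed

lemma forced_walk_vertical:
  assumes "a > 0" "b > 0" "x > 0" "y > 0" "a * y < b * x"
    and "forced_walk (a, b) (x, y + 1) ss z"
  shows "forced_walk (a, b) (x, y) ((0, 1) # ss) z"
  using assms
  by (intro forced_walk_step)
     (auto simp: half_line_iff strictly_below_iff strictly_above_iff step_towards.simps)

lemma forced_walk_horizontal:
  assumes "a > 0" "b > 0" "x > 0" "y > 0" "b * x < a * y"
    and "forced_walk (a, b) (x + 1, y) ss z"
  shows "forced_walk (a, b) (x, y) ((1, 0) # ss) z"
  using assms
  by (intro forced_walk_step)
     (auto simp: half_line_iff strictly_below_iff strictly_above_iff step_towards.simps)

text \<open>The last of the \<open>n\<close> steps starts at height \<open>y + n - 1\<close>; if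
  that point is below the half-line, so are all lower ones in the column. For \<open>n = 0\<close>
  there is nothing to check.\<close>

lemma forced_walk_replicate_vertical:
  assumes "a > 0" "b > 0" "x > 0" "y > 0" "n > 0 \<Longrightarrow> a * (y + real n - 1) < b * x"
    and "forced_walk (a, b) (x, y + real n) ss z"
  shows "forced_walk (a, b) (x, y) (replicate n (0, 1) @ ss) z"
  using assms
proof (induction n arbitrary: y)
  case (Suc n)
  have "a * y \<le> a * (y + real n)"
    using Suc.prems(1) by simp
  also have "\<dots> < b * x"
    using Suc.prems(5) by simp
  finally have "a * y < b * x" .
  moreover have "forced_walk (a, b) (x, y + 1) (replicate n (0, 1) @ ss) z"
    using Suc.prems by (intro Suc.IH) (auto simp: add_ac)
  ultimately show ?case
    using Suc.prems by (auto intro: forced_walk_vertical)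
qed simp


section \<open>Staircase continued fractions\<close>

lemma sc_rem_eq: "sc_rem q p k = (k * q) mod p"
  by (induction k) (simp_all add: mod_simps)

lemma sc_length_coprime:
  assumes "coprime p q" "0 < p"
  shows "sc_length q p = p"
  unfolding sc_length_def
proof (rule Least_equality)
  fix i assume "1 \<le> i \<and> sc_rem q p i = 0"
  then have "0 < i" "p dvd i * q"
    by (auto simp: sc_rem_eq)
  then show "p \<le> i"
    using assms by (auto simp: coprime_dvd_mult_left_iff intro: dvd_imp_le)
qed (use assms in \<open>simp add: sc_rem_eq\<close>)

text \<open>Write \<open>k * q\<close> as a multiple of \<open>p\<close> plus its remainder: the
  multiple passes through the division, and what is left defines the next quotient.\<close>

lemma sc_quot_Suc:
  assumes "p > 0"
  shows "k * q div p + sc_quot q p (Suc k) = Suc k * q div p"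
proof -
  have "Suc k * q = (q + k * q mod p) + p * (k * q div p)"
    by simp
  also have "\<dots> div p = k * q div p + (q + k * q mod p) div p"
    using assms by (intro div_mult_self2) simp
  finally show ?thesis
    by (simp only: sc_quot_def sc_rem_eq diff_Suc_1)
qed

text \<open>The rest of the walk from its entry into the column with abscissa \<open>Suc k\<close>;
  \<open>k = 0\<close> is the whole walk. The induction descends from the last column,
  \<open>k = p - 1\<close>.\<close>

lemma forced_walk_from_column:
  fixes p q :: nat
  assumes "coprime p q" "0 < p" "p < q" "k < p"
  shows "forced_walk (real p, real q) (real (Suc k), real (Suc (k * q div p)))
    (concat (map (\<lambda>i. replicate (sc_quot q p i) (0, 1) @ [(1, 0)]) [Suc k..<p])
      @ replicate (sc_quot q p p - 1) (0, 1)) (real p, real q)"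
proof -
  have pos: "real p > 0" "real q > 0"
    using assms by auto
  have "k \<le> p - 1"
    using assms by simp
  then show ?thesis
  proof (induction rule: inc_induct)
    case base
    have sum: "(p - 1) * q div p + sc_quot q p p = q"
      using sc_quot_Suc[of p "p - 1" q] assms by simp
    \<comment> \<open>Hence the last quotient is at least 1, and the truncated subtraction in
      \<open>sc_quot q p p - 1\<close> is a genuine one.\<close>
    have "(p - 1) * q div p < q"
      using assms by (simp add: div_less_iff_less_mult mult.commute)
    with sum have eq: "Suc ((p - 1) * q div p) + (sc_quot q p p - 1) = q"
      by simp
    then have eqr: "real (Suc ((p - 1) * q div p)) + real (sc_quot q p p - 1) = real q"
      by (metis of_nat_add)
    have "forced_walk (real p, real q) (real p, real q) [] (real p, real q)"
      using pos by (intro forced_walk_end) (simp add: half_line_iff)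
    then have "forced_walk (real p, real q) (real p, real (Suc ((p - 1) * q div p)))
      (replicate (sc_quot q p p - 1) (0, 1) @ []) (real p, real q)"
      using pos eqr by (intro forced_walk_replicate_vertical) (simp_all only:, simp_all)
    then show ?case
      using assms by simp
  next
    case (step k)
    define f where "f = Suc k * q div p"
    have sum: "k * q div p + sc_quot q p (Suc k) = f"
      unfolding f_def using assms(2) by (rule sc_quot_Suc)
    have "\<not> p dvd Suc k"
      using step.hyps by (auto dest!: dvd_imp_le)
    then have "\<not> p dvd Suc k * q"
      using coprime_dvd_mult_left_iff[OF assms(1)] by blast
    then have "0 < Suc k * q mod p"
      by (simp add: dvd_eq_mod_eq_0)
    moreover have "Suc k * q mod p < p"
      using assms by simp
    moreover have "Suc k * q = p * f + Suc k * q mod p"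
      unfolding f_def by simp
    \<comment> \<open>The half-line crosses this column strictly between heights \<open>f\<close>
      and \<open>Suc f\<close>: the last vertical step starts at \<open>f\<close>, and the
      horizontal step is taken at \<open>Suc f\<close>.\<close>
    ultimately have "p * f < q * Suc k" "q * Suc k < p * Suc f"
      by (simp_all add: mult.commute)
    then have below: "real p * real f < real q * real (Suc k)"
      and above: "real q * real (Suc k) < real p * real (Suc f)"
      by (metis of_nat_less_iff of_nat_mult)+
    let ?ss = "concat (map (\<lambda>i. replicate (sc_quot q p i) (0, 1) @ [(1, 0)]) [Suc (Suc k)..<p])
      @ replicate (sc_quot q p p - 1) (0, 1)"
    have "forced_walk (real p, real q) (real (Suc k) + 1, real (Suc f)) ?ss (real p, real q)"
      using step.IH by (simp add: f_def add_ac)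
    then have "forced_walk (real p, real q) (real (Suc k), real (Suc f)) ((1, 0) # ?ss) (real p, real q)"
      using pos above by (intro forced_walk_horizontal) simp_all
    moreover have eqr: "real (Suc (k * q div p)) + real (sc_quot q p (Suc k)) = real (Suc f)"
      using sum by simp
    ultimately have "forced_walk (real p, real q) (real (Suc k), real (Suc (k * q div p)))
      (replicate (sc_quot q p (Suc k)) (0, 1) @ (1, 0) # ?ss) (real p, real q)"
      using pos below by (intro forced_walk_replicate_vertical) (simp_all only:, simp_all)
    moreover have "[Suc k..<p] = Suc k # [Suc (Suc k)..<p]"
      using step.hyps by (simp add: upt_conv_Cons)
    ultimately show ?case
      by simp
  qed
qed

theorem theorem1:
  fixes p q :: nat and d :: "nat \<Rightarrow> nat" and steps :: "(real \<times> real) list"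
  assumes "coprime p q" and "0 < p" and "p < q"
    and "\<And>i. 1 \<le> i \<Longrightarrow> i \<le> p \<Longrightarrow> d i = SC q p ! (i - 1)"
    and "steps = concat (map (\<lambda>i. replicate (d i) (0, 1) @ [(1, 0)]) [1..<p])
                 @ replicate (d p - 1) (0, 1)"
  shows "length (SC q p) = p \<and>
    (\<forall>xs. walk_towards (real p, real q) (1, 1) xs \<longleftrightarrow> xs = trajectory (1, 1) steps) \<and>
    last (trajectory (1, 1) steps) = (real p, real q)"
proof -
  have len: "length (SC q p) = p"
    using sc_length_coprime[OF assms(1,2)] by (simp add: SC_def)
  \<comment> \<open>List positions start at 0 and quotients at 1, hence the shift by one.\<close>
  have d: "d i = sc_quot q p i" if "1 \<le> i" "i \<le> p" for i
    using that assms(4)[OF that] sc_length_coprime[OF assms(1,2)]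
    by (simp add: SC_def del: upt_Suc)
  have map_eq: "map (\<lambda>i. replicate (d i) (0, 1) @ [(1, 0)]) [1..<p]
      = map (\<lambda>i. replicate (sc_quot q p i) (0, 1) @ [(1, 0) :: point]) [1..<p]"
    by (simp add: d)
  have "steps = concat (map (\<lambda>i. replicate (sc_quot q p i) (0, 1) @ [(1, 0)]) [Suc 0..<p])
      @ replicate (sc_quot q p p - 1) (0, 1)"
    unfolding assms(5) map_eq using assms(2) d by simp
  then have "forced_walk (real p, real q) (1, 1) steps (real p, real q)"
    using forced_walk_from_column[OF assms(1-3), of 0] assms(2) by simp
  with len show ?thesis
    by (simp add: forced_walk_def)
qed

end
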